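(* In Carnot groups, n-convex functions are the same as h-convex functions: for a Carnot group $G$, a subset $\Omega\subset G$ and a function $f:\Omega\to\mathbb{R}$, $f$ is n-convex on $\Omega$ if and only if $f$ is h-convex on $\Omega$.
   Context: A Carnot group $G$ is a connected, simply connected Lie group whose Lie algebra has a grading $\mathcal G=V_1\oplus\cdots\oplus V_l$ with $[V_1,V_i]=V_{i+1}$ for $1\le i\le l-1$ and $[V_1,V_l]=0$. Let $\{e_1,\dots,e_m\}$ be a basis of $\mathcal G$ adapted to the grading, with $e_1,\dots,e_k$ a basis of $V_1$, and let $X_i$ be the left-invariant vector field with value $e_i$ at the identity. The horizontal bundle is $\Sigma=\mathrm{span}\{X_1,\dots,X_k\}$, $g$ is the left-invariant Riemannian metric for which $X_1,\dots,X_m$ are orthonormal, and $g_c=g|_\Sigma$. Let $\nabla$ be the Levi-Civita connection of $g$ and $\mathcal P$ the $g$-orthogonal projection onto $\Sigma$. A nonholonomic geodesic is a smooth horizontal curve $\gamma$ (i.e. $\dot\gamma\in\Sigma_\gamma$) with $D_{\dot\gamma}\dot\gamma:=\mathcal P(\nabla_{\dot\gamma}\dot\gamma)=0$. A subset $\Omega\subset G$ is n-convex if, whenever $p,q\in\Omega$ and there exists a nonholonomic geodesic connecting them, its segment between $p$ and $q$ lies in $\Omega$. A function $f$ on $\Omega$ is n-convex if $\Omega$ is n-convex and $f\circ\gamma$ is convex for every nonholonomic geodesic $\gamma$ contained in $\Omega$. A subset $\Omega\subset G$ is h-convex (Danielli-Garofalo-Nhieu) if, whenever two points on an integral curve of some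 left-invariant horizontal vector field belong to $\Omega$, the whole segment of the integral curve between these two points is contained in $\Omega$. A function $f$ on $\Omega$ is h-convex if $\Omega$ is h-convex and $f$ is convex along the integral curves, contained in $\Omega$, of the left-invariant horizontal vector fields. *)

theory Defs
  imports
    "HOL-Analysis.Analysis"
    "HOL-Library.Function_Algebras"
    "HOL-Algebra.Group"
begin

section \<open>Functions as a real vector space\<close>

text \<open>Tangent vectors and vector fields below are functions with pointwise operations
  (addition is the one of \<^theory>\<open>HOL-Library.Function_Algebras\<close>); with this instance
  \<^const>\<open>span\<close>, \<^const>\<open>subspace\<close> and \<^const>\<open>dependent\<close> apply to them.\<close>

instantiation "fun" :: (type, real_vector) real_vector
begin

definition scaleR_fun :: "real \<Rightarrow> ('a \<Rightarrow> 'b) \<Rightarrow> 'a \<Rightarrow> 'b" where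
  "scaleR_fun c f = (\<lambda>x. c *\<^sub>R f x)"

instance
  by standard
    (simp_all add: scaleR_fun_def fun_eq_iff scaleR_add_right scaleR_add_left)

end


section \<open>Smooth manifolds\<close>

text \<open>Only used on open sets, where \<open>Ck_on n\<close> for all \<open>n\<close> is \<open>C\<^sup>\<infinity>\<close>.\<close>

primrec Ck_on :: "nat \<Rightarrow> 'a::euclidean_space set \<Rightarrow> ('a \<Rightarrow> 'b::euclidean_space) \<Rightarrow> bool" where
  "Ck_on 0 S f \<longleftrightarrow> continuous_on S f"
| "Ck_on (Suc n) S f \<longleftrightarrow>
     (\<forall>x\<in>S. f differentiable (at x)) \<and>
     (\<forall>v. Ck_on n S (\<lambda>x. frechet_derivative f (at x) v))"

definition smooth_on :: "'a::euclidean_space set \<Rightarrow> ('a \<Rightarrow> 'b::euclidean_space) \<Rightarrow> bool" where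
  "smooth_on S f \<longleftrightarrow> (\<forall>n. Ck_on n S f)"

text \<open>A chart is a pair of its domain \<open>U\<close> and a coordinate map, relevant on \<open>U\<close> only.\<close>

type_synonym ('a, 'e) chart = "'a set \<times> ('a \<Rightarrow> 'e)"

definition is_chart :: "('a::topological_space, 'e::euclidean_space) chart \<Rightarrow> bool" where
  "is_chart = (\<lambda>(U, \<phi>). open U \<and> open (\<phi> ` U) \<and> inj_on \<phi> U \<and>
     homeomorphism U (\<phi> ` U) \<phi> (inv_into U \<phi>))"

definition atlas_carrier :: "('a, 'e) chart set \<Rightarrow> 'a set" where
  "atlas_carrier A = \<Union> (fst ` A)"

definition smooth_map ::
  "('a::topological_space, 'e::euclidean_space) chart set \<Rightarrow>
   ('b::topological_space, 'd::euclidean_space) chart set \<Rightarrow> ('a \<Rightarrow> 'b) \<Rightarrow> bool" where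
  "smooth_map A B F \<longleftrightarrow>
     continuous_on (atlas_carrier A) F \<and> F ` atlas_carrier A \<subseteq> atlas_carrier B \<and>
     (\<forall>(U, \<phi>)\<in>A. \<forall>(W, \<psi>)\<in>B.
        smooth_on (\<phi> ` (U \<inter> F -` W)) (\<lambda>x. \<psi> (F (inv_into U \<phi> x))))"

text \<open>A smooth structure on the whole type. The Hausdorff and second countability axioms are
  imposed on the type, and the type of the model space determines the dimension.\<close>

definition smooth_atlas :: "('a::topological_space, 'e::euclidean_space) chart set \<Rightarrow> bool" where
  "smooth_atlas A \<longleftrightarrow>
     atlas_carrier A = UNIV \<and> (\<forall>c\<in>A. is_chart c) \<and>
     (\<forall>(U, \<phi>)\<in>A. \<forall>(W, \<psi>)\<in>A. smooth_on (\<phi> ` (U \<inter> W)) (\<lambda>x. \<psi> (inv_into U \<phi> x)))"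

definition prod_atlas ::
  "('a, 'e) chart set \<Rightarrow> ('b, 'd) chart set \<Rightarrow> ('a \<times> 'b, 'e \<times> 'd) chart set" where
  "prod_atlas A B = {(U \<times> W, map_prod \<phi> \<psi>) | U \<phi> W \<psi>. (U, \<phi>) \<in> A \<and> (W, \<psi>) \<in> B}"

text \<open>The standard structure on an open set of reals.\<close>

definition line_atlas :: "real set \<Rightarrow> (real, real) chart set" where
  "line_atlas I = {(I, id)}"

definition smooth_functions ::
  "('a::topological_space, 'e::euclidean_space) chart set \<Rightarrow> ('a \<Rightarrow> real) set" where
  "smooth_functions A = {f. smooth_map A (line_atlas UNIV) f}"


section \<open>Tangent vectors and vector fields\<close>

text \<open>A tangent vector at \<open>p\<close> is a derivation at \<open>p\<close> of the algebra of smooth functions. Values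
  outside that algebra are normalised to zero, so that equality of tangent vectors is
  equality in HOL.\<close>

type_synonym 'a tvec = "('a \<Rightarrow> real) \<Rightarrow> real"
type_synonym 'a vfield = "'a \<Rightarrow> 'a tvec"

definition tangent_space ::
  "('a::topological_space, 'e::euclidean_space) chart set \<Rightarrow> 'a \<Rightarrow> 'a tvec set" where
  "tangent_space A p = {v.
     (\<forall>f\<in>smooth_functions A. \<forall>h\<in>smooth_functions A.
        v (\<lambda>x. f x + h x) = v f + v h \<and>
        v (\<lambda>x. f x * h x) = f p * v h + h p * v f) \<and>
     (\<forall>f\<in>smooth_functions A. \<forall>c. v (\<lambda>x. c * f x) = c * v f) \<and>
     (\<forall>f. f \<notin> smooth_functions A \<longrightarrow> v f = 0)}"

definition smooth_vfields ::
  "('a::topological_space, 'e::euclidean_space) chart set \<Rightarrow> 'a vfield set" where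
  "smooth_vfields A = {X.
     (\<forall>p. X p \<in> tangent_space A p) \<and>
     (\<forall>f\<in>smooth_functions A. (\<lambda>p. X p f) \<in> smooth_functions A)}"

definition lie_bracket :: "'a vfield \<Rightarrow> 'a vfield \<Rightarrow> 'a vfield" where
  "lie_bracket X Y = (\<lambda>p f. X p (\<lambda>q. Y q f) - Y p (\<lambda>q. X q f))"

text \<open>The differential of a smooth self-map; by the normalisation of tangent vectors it has to
  vanish on non-smooth functions.\<close>

definition differential ::
  "('a::topological_space, 'e::euclidean_space) chart set \<Rightarrow> ('a \<Rightarrow> 'a) \<Rightarrow> 'a tvec \<Rightarrow> 'a tvec" where
  "differential A F v = (\<lambda>f. if f \<in> smooth_functions A then v (\<lambda>x. f (F x)) else 0)"

definition velocity ::
  "('a::topological_space, 'e::euclidean_space) chart set \<Rightarrow> (real \<Rightarrow> 'a) \<Rightarrow> real \<Rightarrow> 'a tvec" where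
  "velocity A \<gamma> t = (\<lambda>f. if f \<in> smooth_functions A then deriv (\<lambda>s. f (\<gamma> s)) t else 0)"


section \<open>Riemannian metrics and connections\<close>

type_synonym 'a metric = "'a \<Rightarrow> 'a tvec \<Rightarrow> 'a tvec \<Rightarrow> real"

definition riemannian_metric ::
  "('a::topological_space, 'e::euclidean_space) chart set \<Rightarrow> 'a metric \<Rightarrow> bool" where
  "riemannian_metric A g \<longleftrightarrow>
     (\<forall>p. \<forall>u\<in>tangent_space A p. \<forall>v\<in>tangent_space A p.
        g p u v = g p v u \<and>
        (u \<noteq> 0 \<longrightarrow> g p u u > 0) \<and>
        (\<forall>c. g p (c *\<^sub>R u) v = c * g p u v) \<and>
        (\<forall>w\<in>tangent_space A p. g p (u + w) v = g p u v + g p w v)) \<and>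
     (\<forall>X\<in>smooth_vfields A. \<forall>Y\<in>smooth_vfields A.
        (\<lambda>p. g p (X p) (Y p)) \<in> smooth_functions A)"

text \<open>\<open>nab p v Y\<close> is the covariant derivative at \<open>p\<close> of the vector field \<open>Y\<close> in the direction of
  the tangent vector \<open>v\<close> at \<open>p\<close>.\<close>

type_synonym 'a connection = "'a \<Rightarrow> 'a tvec \<Rightarrow> 'a vfield \<Rightarrow> 'a tvec"

definition affine_connection ::
  "('a::topological_space, 'e::euclidean_space) chart set \<Rightarrow> 'a connection \<Rightarrow> bool" where
  "affine_connection A nab \<longleftrightarrow>
     (\<forall>p. \<forall>v\<in>tangent_space A p. \<forall>Y\<in>smooth_vfields A.
        nab p v Y \<in> tangent_space A p \<and>
        (\<forall>c. nab p (c *\<^sub>R v) Y = c *\<^sub>R nab p v Y) \<and>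
        (\<forall>w\<in>tangent_space A p. nab p (v + w) Y = nab p v Y + nab p w Y) \<and>
        (\<forall>Z\<in>smooth_vfields A. nab p v (\<lambda>q. Y q + Z q) = nab p v Y + nab p v Z) \<and>
        (\<forall>h\<in>smooth_functions A.
           nab p v (\<lambda>q. h q *\<^sub>R Y q) = v h *\<^sub>R Y p + h p *\<^sub>R nab p v Y)) \<and>
     (\<forall>X\<in>smooth_vfields A. \<forall>Y\<in>smooth_vfields A. (\<lambda>p. nab p (X p) Y) \<in> smooth_vfields A)"

definition levi_civita ::
  "('a::topological_space, 'e::euclidean_space) chart set \<Rightarrow> 'a metric \<Rightarrow> 'a connection \<Rightarrow> bool" where
  "levi_civita A g nab \<longleftrightarrow>
     affine_connection A nab \<and>
     (\<forall>X\<in>smooth_vfields A. \<forall>Y\<in>smooth_vfields A. \<forall>p.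
        nab p (X p) Y - nab p (Y p) X = lie_bracket X Y p) \<and>
     (\<forall>X\<in>smooth_vfields A. \<forall>Y\<in>smooth_vfields A. \<forall>Z\<in>smooth_vfields A. \<forall>p.
        X p (\<lambda>q. g q (Y q) (Z q)) =
          g p (nab p (X p) Y) (Z p) + g p (Y p) (nab p (X p) Z))"

text \<open>\<open>Z\<close> is the covariant derivative along the curve \<open>\<gamma>\<close> of the vector field \<open>W\<close> along \<open>\<gamma>\<close>:
  writing \<open>W t = (\<Sum>a<n. w a t *\<^sub>R Y a (\<gamma> t))\<close> with smooth \<open>w a\<close> and smooth vector fields \<open>Y a\<close>,
  the derivative is given by the product rule and
  \<open>D (Y a \<circ> \<gamma>) = nab \<gamma>' (Y a)\<close>. Every smooth \<open>W\<close> admits such an expression (the smooth vector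
  fields are finitely generated over the smooth functions), and the result does not depend
  on it.\<close>

definition cov_deriv_along ::
  "('a::topological_space, 'e::euclidean_space) chart set \<Rightarrow> 'a connection \<Rightarrow> real set \<Rightarrow>
   (real \<Rightarrow> 'a) \<Rightarrow> (real \<Rightarrow> 'a tvec) \<Rightarrow> (real \<Rightarrow> 'a tvec) \<Rightarrow> bool" where
  "cov_deriv_along A nab I \<gamma> W Z \<longleftrightarrow>
     (\<exists>(n::nat) (w :: nat \<Rightarrow> real \<Rightarrow> real) (Y :: nat \<Rightarrow> 'a vfield).
        (\<forall>a<n. smooth_on I (w a) \<and> Y a \<in> smooth_vfields A) \<and>
        (\<forall>t\<in>I. W t = (\<Sum>a<n. w a t *\<^sub>R Y a (\<gamma> t)) \<and>
               Z t = (\<Sum>a<n. deriv (w a) t *\<^sub>R Y a (\<gamma> t) +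
                             w a t *\<^sub>R nab (\<gamma> t) (velocity A \<gamma> t) (Y a))))"

definition orth_proj :: "'a metric \<Rightarrow> 'a \<Rightarrow> 'a tvec set \<Rightarrow> 'a tvec \<Rightarrow> 'a tvec" where
  "orth_proj g p S v = (THE w. w \<in> S \<and> (\<forall>s\<in>S. g p (v - w) s = 0))"


section \<open>Carnot groups\<close>

definition lie_group ::
  "'a::{t2_space, second_countable_topology} monoid \<Rightarrow>
   ('a, 'e::euclidean_space) chart set \<Rightarrow> bool" where
  "lie_group G A \<longleftrightarrow>
     group G \<and> carrier G = UNIV \<and> smooth_atlas A \<and>
     smooth_map (prod_atlas A A) A (\<lambda>(x, y). x \<otimes>\<^bsub>G\<^esub> y) \<and>
     smooth_map A A (\<lambda>x. inv\<^bsub>G\<^esub> x)"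

text \<open>The Lie algebra of \<open>G\<close>.\<close>

definition left_inv_vfields ::
  "'a::topological_space monoid \<Rightarrow> ('a, 'e::euclidean_space) chart set \<Rightarrow> 'a vfield set" where
  "left_inv_vfields G A = {X \<in> smooth_vfields A.
     \<forall>a p. X (a \<otimes>\<^bsub>G\<^esub> p) = differential A (\<lambda>x. a \<otimes>\<^bsub>G\<^esub> x) (X p)}"

definition bracket_space :: "'a vfield set \<Rightarrow> 'a vfield set \<Rightarrow> 'a vfield set" where
  "bracket_space V W = span {lie_bracket X Y | X Y. X \<in> V \<and> Y \<in> W}"

definition stratification ::
  "'a::topological_space monoid \<Rightarrow> ('a, 'e::euclidean_space) chart set \<Rightarrow>
   (nat \<Rightarrow> 'a vfield set) \<Rightarrow> nat \<Rightarrow> bool" where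
  "stratification G A V l \<longleftrightarrow>
     1 \<le> l \<and>
     (\<forall>i\<in>{1..l}. subspace (V i) \<and> V i \<subseteq> left_inv_vfields G A) \<and>
     (\<forall>X\<in>left_inv_vfields G A. \<exists>!v. v \<in> (\<Pi>\<^sub>E i\<in>{1..l}. V i) \<and> X = (\<Sum>i\<in>{1..l}. v i)) \<and>
     (\<forall>i. 1 \<le> i \<and> i < l \<longrightarrow> bracket_space (V 1) (V i) = V (Suc i)) \<and>
     bracket_space (V 1) (V l) = {0}"

definition carnot_group ::
  "'a::{t2_space, second_countable_topology} monoid \<Rightarrow>
   ('a, 'e::euclidean_space) chart set \<Rightarrow> (nat \<Rightarrow> 'a vfield set) \<Rightarrow> nat \<Rightarrow> bool" where
  "carnot_group G A V l \<longleftrightarrow>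
     lie_group G A \<and> connected (UNIV :: 'a set) \<and> simply_connected (UNIV :: 'a set) \<and>
     stratification G A V l"

text \<open>\<open>X 1, \<dots>, X m\<close> is a basis of the Lie algebra, numbered layer by layer: the layer \<open>V i\<close> is
  spanned by the \<open>X j\<close> with \<open>d (i - 1) < j \<le> d i\<close>, where \<open>d 1 = k\<close>.\<close>

definition adapted_basis ::
  "'a::topological_space monoid \<Rightarrow> ('a, 'e::euclidean_space) chart set \<Rightarrow>
   (nat \<Rightarrow> 'a vfield set) \<Rightarrow> nat \<Rightarrow> (nat \<Rightarrow> 'a vfield) \<Rightarrow> nat \<Rightarrow> nat \<Rightarrow> bool" where
  "adapted_basis G A V l X m k \<longleftrightarrow>
     inj_on X {1..m} \<and> independent (X ` {1..m}) \<and> span (X ` {1..m}) = left_inv_vfields G A \<and>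
     (\<exists>d :: nat \<Rightarrow> nat. mono d \<and> d 0 = 0 \<and> d 1 = k \<and> d l = m \<and>
        (\<forall>i\<in>{1..l}. V i = span (X ` {d (i - 1)<..d i})))"

definition left_inv_metric ::
  "'a::topological_space monoid \<Rightarrow> ('a, 'e::euclidean_space) chart set \<Rightarrow> 'a metric \<Rightarrow> bool" where
  "left_inv_metric G A g \<longleftrightarrow>
     riemannian_metric A g \<and>
     (\<forall>a p. \<forall>u\<in>tangent_space A p. \<forall>v\<in>tangent_space A p.
        g (a \<otimes>\<^bsub>G\<^esub> p) (differential A (\<lambda>x. a \<otimes>\<^bsub>G\<^esub> x) u) (differential A (\<lambda>x. a \<otimes>\<^bsub>G\<^esub> x) v)
          = g p u v)"

definition orthonormal_frame :: "'a metric \<Rightarrow> (nat \<Rightarrow> 'a vfield) \<Rightarrow> nat \<Rightarrow> bool" where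
  "orthonormal_frame g X m \<longleftrightarrow>
     (\<forall>p. \<forall>i\<in>{1..m}. \<forall>j\<in>{1..m}. g p (X i p) (X j p) = (if i = j then 1 else 0))"

definition horizontal :: "(nat \<Rightarrow> 'a vfield) \<Rightarrow> nat \<Rightarrow> 'a \<Rightarrow> 'a tvec set" where
  "horizontal X k p = span ((\<lambda>i. X i p) ` {1..k})"


section \<open>The two notions of convexity\<close>

text \<open>Curves are parametrised by open intervals \<open>I\<close>, so that derivatives are two-sided. A piece of
  such a curve contained in \<open>\<Omega>\<close> is its restriction to a subinterval \<open>J\<close> of \<open>I\<close>, which need not be
  open.\<close>

definition smooth_curve ::
  "('a::topological_space, 'e::euclidean_space) chart set \<Rightarrow> real set \<Rightarrow> (real \<Rightarrow> 'a) \<Rightarrow> bool" where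
  "smooth_curve A I \<gamma> \<longleftrightarrow> open I \<and> is_interval I \<and> smooth_map (line_atlas I) A \<gamma>"

definition nonholonomic_geodesic ::
  "('a::topological_space, 'e::euclidean_space) chart set \<Rightarrow> 'a metric \<Rightarrow> 'a connection \<Rightarrow>
   (nat \<Rightarrow> 'a vfield) \<Rightarrow> nat \<Rightarrow> real set \<Rightarrow> (real \<Rightarrow> 'a) \<Rightarrow> bool" where
  "nonholonomic_geodesic A g nab X k I \<gamma> \<longleftrightarrow>
     smooth_curve A I \<gamma> \<and>
     (\<forall>t\<in>I. velocity A \<gamma> t \<in> horizontal X k (\<gamma> t)) \<and>
     (\<exists>Z. cov_deriv_along A nab I \<gamma> (velocity A \<gamma>) Z \<and>
          (\<forall>t\<in>I. orth_proj g (\<gamma> t) (horizontal X k (\<gamma> t)) (Z t) = 0))"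

definition integral_curve ::
  "('a::topological_space, 'e::euclidean_space) chart set \<Rightarrow> 'a vfield \<Rightarrow> real set \<Rightarrow>
   (real \<Rightarrow> 'a) \<Rightarrow> bool" where
  "integral_curve A Y I \<gamma> \<longleftrightarrow> smooth_curve A I \<gamma> \<and> (\<forall>t\<in>I. velocity A \<gamma> t = Y (\<gamma> t))"

definition left_inv_horizontal_vfields ::
  "'a::topological_space monoid \<Rightarrow> ('a, 'e::euclidean_space) chart set \<Rightarrow>
   (nat \<Rightarrow> 'a vfield) \<Rightarrow> nat \<Rightarrow> 'a vfield set" where
  "left_inv_horizontal_vfields G A X k =
     {Y \<in> left_inv_vfields G A. \<forall>p. Y p \<in> horizontal X k p}"

definition n_convex_set ::
  "('a::topological_space, 'e::euclidean_space) chart set \<Rightarrow> 'a metric \<Rightarrow> 'a connection \<Rightarrow>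
   (nat \<Rightarrow> 'a vfield) \<Rightarrow> nat \<Rightarrow> 'a set \<Rightarrow> bool" where
  "n_convex_set A g nab X k \<Omega> \<longleftrightarrow>
     (\<forall>p\<in>\<Omega>. \<forall>q\<in>\<Omega>. \<forall>I \<gamma>. nonholonomic_geodesic A g nab X k I \<gamma> \<longrightarrow>
        (\<forall>a\<in>I. \<forall>b\<in>I. \<gamma> a = p \<and> \<gamma> b = q \<longrightarrow> \<gamma> ` closed_segment a b \<subseteq> \<Omega>))"

definition n_convex_fun ::
  "('a::topological_space, 'e::euclidean_space) chart set \<Rightarrow> 'a metric \<Rightarrow> 'a connection \<Rightarrow>
   (nat \<Rightarrow> 'a vfield) \<Rightarrow> nat \<Rightarrow> 'a set \<Rightarrow> ('a \<Rightarrow> real) \<Rightarrow> bool" where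
  "n_convex_fun A g nab X k \<Omega> f \<longleftrightarrow>
     n_convex_set A g nab X k \<Omega> \<and>
     (\<forall>I \<gamma>. nonholonomic_geodesic A g nab X k I \<gamma> \<longrightarrow>
        (\<forall>J. is_interval J \<and> J \<subseteq> I \<and> \<gamma> ` J \<subseteq> \<Omega> \<longrightarrow> convex_on J (f \<circ> \<gamma>)))"

definition h_convex_set ::
  "'a::topological_space monoid \<Rightarrow> ('a, 'e::euclidean_space) chart set \<Rightarrow>
   (nat \<Rightarrow> 'a vfield) \<Rightarrow> nat \<Rightarrow> 'a set \<Rightarrow> bool" where
  "h_convex_set G A X k \<Omega> \<longleftrightarrow>
     (\<forall>Y\<in>left_inv_horizontal_vfields G A X k. \<forall>I \<gamma>. integral_curve A Y I \<gamma> \<longrightarrow>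
        (\<forall>a\<in>I. \<forall>b\<in>I. \<gamma> a \<in> \<Omega> \<and> \<gamma> b \<in> \<Omega> \<longrightarrow> \<gamma> ` closed_segment a b \<subseteq> \<Omega>))"

definition h_convex_fun ::
  "'a::topological_space monoid \<Rightarrow> ('a, 'e::euclidean_space) chart set \<Rightarrow>
   (nat \<Rightarrow> 'a vfield) \<Rightarrow> nat \<Rightarrow> 'a set \<Rightarrow> ('a \<Rightarrow> real) \<Rightarrow> bool" where
  "h_convex_fun G A X k \<Omega> f \<longleftrightarrow>
     h_convex_set G A X k \<Omega> \<and>
     (\<forall>Y\<in>left_inv_horizontal_vfields G A X k. \<forall>I \<gamma>. integral_curve A Y I \<gamma> \<longrightarrow>
        (\<forall>J. is_interval J \<and> J \<subseteq> I \<and> \<gamma> ` J \<subseteq> \<Omega> \<longrightarrow> convex_on J (f \<circ> \<gamma>)))"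

end

theory Submission
  imports Defs
begin

text \<open>The two notions of convexity quantify over two families of curves, and these families
  coincide: a curve is a nonholonomic geodesic exactly if it is an integral curve, on the same
  interval and with the same parametrisation, of a left-invariant horizontal vector field.

  Let \<open>H = V 1\<close> be the space of left-invariant horizontal fields. The number
  \<open>g (\<nabla>\<^sub>U V) W\<close> vanishes for all \<open>U\<close>, \<open>V\<close>, \<open>W\<close> in \<open>H\<close>: it is symmetric in \<open>U\<close>, \<open>V\<close>, because the
  connection is torsion free and \<open>[U, V]\<close>, which lies in the second layer or is zero, is
  orthogonal to \<open>W\<close>; it is antisymmetric in \<open>V\<close>, \<open>W\<close>, because the connection is metric and
  \<open>g V W\<close> is constant; and a trilinear form with both symmetries is zero (\<open>nabla_orthogonal\<close>).

  For an integral curve of \<open>Y \<in> H\<close> the covariant acceleration is \<open>\<nabla>\<^sub>Y Y\<close>, which is therefore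
  orthogonal to the horizontal space. Conversely, for a nonholonomic geodesic \<open>\<gamma>\<close> and \<open>W \<in> H\<close>, the
  derivative of \<open>g \<gamma>' W\<close> is the sum of \<open>g (\<nabla>\<^sub>\<gamma>\<^sub>' \<gamma>') W\<close>, which is zero for geodesics, and
  \<open>g \<gamma>' (\<nabla>\<^sub>\<gamma>\<^sub>' W)\<close>, which is zero by the same identity. So the components of \<open>\<gamma>'\<close> in a left-invariant
  orthonormal frame are constant, which says that \<open>\<gamma>\<close> follows one field of \<open>H\<close>
  (\<open>nonholonomic_geodesic_iff\<close>).

  A left-invariant field is determined by its value at one point, so the left-invariant fields with
  horizontal values are exactly those in \<open>H\<close>, and the two families of curves agree.\<close>

section \<open>Smooth functions and tangent vectors\<close>

lemma smooth_on_const: "smooth_on S (\<lambda>_. c)"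
proof -
  have "Ck_on n S (\<lambda>_. c)" for n and c :: 'b
    by (induction n arbitrary: c) (simp_all add: frechet_derivative_const)
  then show ?thesis by (simp add: smooth_on_def)
qed

lemma smooth_on_imp_differentiable:
  assumes "smooth_on S f" "x \<in> S"
  shows "f differentiable (at x)"
proof -
  have "Ck_on (Suc 0) S f" using assms(1) unfolding smooth_on_def by blast
  then show ?thesis using assms(2) by simp
qed

lemma const_smooth_function: "(\<lambda>_. c) \<in> smooth_functions A"
  by (auto simp: smooth_functions_def smooth_map_def line_atlas_def atlas_carrier_def
      intro: smooth_on_const)

lemma differentiable_transform_open:
  assumes "f differentiable (at x)" "open S" "x \<in> S" "\<And>y. y \<in> S \<Longrightarrow> f y = h y"
  shows "h differentiable (at x)"
  using assms has_derivative_transform_within_open[of f _ x UNIV S h]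
  by (auto simp: differentiable_def)

lemma smooth_map_line_differentiable:
  assumes "smooth_map (line_atlas I) A \<gamma>" "(W, \<psi>) \<in> A" "t \<in> I" "\<gamma> t \<in> W" "open I"
  shows "(\<lambda>s. \<psi> (\<gamma> s)) differentiable (at t)"
proof -
  have sm: "smooth_on (id ` (I \<inter> \<gamma> -` W)) (\<lambda>x. \<psi> (\<gamma> (inv_into I id x)))"
    using assms(1,2) unfolding smooth_map_def line_atlas_def by fastforce
  have "(\<lambda>x. \<psi> (\<gamma> (inv_into I id x))) differentiable (at t)"
    by (rule smooth_on_imp_differentiable[OF sm]) (use assms in auto)
  then show ?thesis
    by (rule differentiable_transform_open[OF _ assms(5,3)]) (use inv_into_f_f[of id I] in simp)
qed

text \<open>Velocities are defined through \<open>deriv\<close>, which is meaningful because smooth functions are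
  differentiable along smooth curves: factor through any chart around the point.\<close>

lemma smooth_function_along_curve:
  fixes A :: "('a::topological_space, 'e::euclidean_space) chart set"
  assumes A: "smooth_atlas A" and c: "smooth_curve A I \<gamma>" and h: "h \<in> smooth_functions A"
    and t: "t \<in> I"
  shows "((\<lambda>s. h (\<gamma> s)) has_real_derivative velocity A \<gamma> t h) (at t)"
proof -
  have I: "open I" and sm: "smooth_map (line_atlas I) A \<gamma>"
    using c by (auto simp: smooth_curve_def)
  have cont: "continuous_on I \<gamma>"
    using sm by (simp add: smooth_map_def line_atlas_def atlas_carrier_def)
  obtain U \<phi> where U: "(U, \<phi>) \<in> A" "\<gamma> t \<in> U"
  proof -
    have "\<gamma> t \<in> atlas_carrier A" using A by (simp add: smooth_atlas_def)
    then show ?thesis using that by (auto simp: atlas_carrier_def)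
  qed
  have ch: "open U" "inj_on \<phi> U"
  proof -
    have "is_chart (U, \<phi>)" using A U(1) unfolding smooth_atlas_def by blast
    then show "open U" "inj_on \<phi> U" by (simp_all add: is_chart_def)
  qed
  have 1: "(\<lambda>s. \<phi> (\<gamma> s)) differentiable (at t)"
    by (rule smooth_map_line_differentiable[OF sm U(1) t U(2) I])
  have "smooth_on (\<phi> ` (U \<inter> h -` UNIV)) (\<lambda>x. id (h (inv_into U \<phi> x)))"
    using h U(1) unfolding smooth_functions_def smooth_map_def line_atlas_def by fastforce
  from smooth_on_imp_differentiable[OF this, of "\<phi> (\<gamma> t)"] U(2)
  have 2: "(\<lambda>x. h (inv_into U \<phi> x)) differentiable (at (\<phi> (\<gamma> t)))" by simp
  have 3: "((\<lambda>x. h (inv_into U \<phi> x)) \<circ> (\<lambda>s. \<phi> (\<gamma> s))) differentiable (at t)"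
    by (rule differentiable_chain_at[OF 1 2])
  have op: "open (I \<inter> \<gamma> -` U)"
    using continuous_open_preimage[OF cont I ch(1)] .
  have eq: "((\<lambda>x. h (inv_into U \<phi> x)) \<circ> (\<lambda>s. \<phi> (\<gamma> s))) s = h (\<gamma> s)" if "s \<in> I \<inter> \<gamma> -` U" for s
    using ch(2) that by simp
  have "(\<lambda>s. h (\<gamma> s)) differentiable (at t)"
    by (rule differentiable_transform_open[OF 3 op _ eq]) (use t U(2) in auto)
  then have "((\<lambda>s. h (\<gamma> s)) has_real_derivative deriv (\<lambda>s. h (\<gamma> s)) t) (at t)"
    using DERIV_deriv_iff_real_differentiable by blast
  then show ?thesis
    using h by (simp add: velocity_def)
qed

lemma subspace_tangent_space: "subspace (tangent_space A p)"
  by (rule subspaceI)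
    (auto simp: tangent_space_def scaleR_fun_def plus_fun_def zero_fun_def algebra_simps)

lemma tangent_vector_const:
  assumes "v \<in> tangent_space A p"
  shows "v (\<lambda>_. c) = 0"
proof -
  have "v (\<lambda>x. f x * h x) = f p * v h + h p * v f" "v (\<lambda>x. c * f x) = c * v f"
    if "f \<in> smooth_functions A" "h \<in> smooth_functions A" for f h c
    using assms that by (simp_all add: tangent_space_def)
  from this(1)[OF const_smooth_function[of 1] const_smooth_function[of 1]]
    this(2)[OF const_smooth_function[of 1] const_smooth_function[of 1], of c]
  show ?thesis by simp
qed

lemma scaleR_fun_apply: "(c *\<^sub>R f) x = c *\<^sub>R f x"
  by (simp add: scaleR_fun_def)

lemma span_eval: "span ((\<lambda>U. U p) ` F) = (\<lambda>U. U p) ` span F"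
  for F :: "'a vfield set"
proof -
  have "linear (\<lambda>U :: 'a vfield. U p)"
    by (rule linearI) (simp_all add: scaleR_fun_apply)
  then show ?thesis
    by (rule linear_span_image)
qed


section \<open>Riemannian metrics\<close>

locale riemannian =
  fixes A :: "('a::topological_space, 'e::euclidean_space) chart set" and g :: "'a metric"
  assumes metric: "riemannian_metric A g"
begin

abbreviation T where "T \<equiv> tangent_space A"

lemma T_zero: "0 \<in> T p"
  and T_add: "u \<in> T p \<Longrightarrow> v \<in> T p \<Longrightarrow> u + v \<in> T p"
  and T_diff: "u \<in> T p \<Longrightarrow> v \<in> T p \<Longrightarrow> u - v \<in> T p"
  and T_scale: "u \<in> T p \<Longrightarrow> c *\<^sub>R u \<in> T p"
  by (rule subspace_0 subspace_add subspace_diff subspace_scale;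
      (assumption | rule subspace_tangent_space))+

lemma T_sum: "(\<And>i. i \<in> S \<Longrightarrow> u i \<in> T p) \<Longrightarrow> (\<Sum>i\<in>S. u i) \<in> T p"
  by (rule subspace_sum[OF subspace_tangent_space])

lemma T_span: "B \<subseteq> T p \<Longrightarrow> u \<in> span B \<Longrightarrow> u \<in> T p"
  using span_minimal[OF _ subspace_tangent_space] by blast

lemma field_tangent: "U \<in> smooth_vfields A \<Longrightarrow> U p \<in> T p"
  by (simp add: smooth_vfields_def)

lemma g_sym: "u \<in> T p \<Longrightarrow> v \<in> T p \<Longrightarrow> g p u v = g p v u"
  using metric by (simp add: riemannian_metric_def)

lemma g_pos: "u \<in> T p \<Longrightarrow> u \<noteq> 0 \<Longrightarrow> g p u u > 0"
  using metric by (simp add: riemannian_metric_def)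

lemma g_scale: "u \<in> T p \<Longrightarrow> v \<in> T p \<Longrightarrow> g p (c *\<^sub>R u) v = c * g p u v"
  using metric by (simp add: riemannian_metric_def)

lemma g_add: "u \<in> T p \<Longrightarrow> w \<in> T p \<Longrightarrow> v \<in> T p \<Longrightarrow> g p (u + w) v = g p u v + g p w v"
  using metric by (simp add: riemannian_metric_def)

lemma g_zero: "v \<in> T p \<Longrightarrow> g p 0 v = 0"
  using g_scale[of v p v 0] by simp

lemma g_diff:
  assumes "u \<in> T p" "w \<in> T p" "v \<in> T p"
  shows "g p (u - w) v = g p u v - g p w v"
  using g_add[OF T_diff[OF assms(1,2)] assms(2,3)] by simp

lemma g_sum:
  assumes "\<And>i. i \<in> S \<Longrightarrow> u i \<in> T p" "v \<in> T p"
  shows "g p (\<Sum>i\<in>S. u i) v = (\<Sum>i\<in>S. g p (u i) v)"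
proof (cases "finite S")
  case True
  then show ?thesis
    using assms(1)
  proof (induction S)
    case empty
    have "g p (\<Sum>i\<in>{}. u i) v = (\<Sum>i\<in>{}. g p (u i) v)"
      by (simp only: sum.empty g_zero[OF assms(2)])
    then show ?case .
  next
    case (insert x F)
    have "g p (u x + (\<Sum>i\<in>F. u i)) v = g p (u x) v + g p (\<Sum>i\<in>F. u i) v"
      using insert.prems assms(2) by (intro g_add T_sum) auto
    moreover have "(\<Sum>i\<in>insert x F. u i) = u x + (\<Sum>i\<in>F. u i)"
      using insert.hyps by (rule sum.insert)
    moreover have "g p (\<Sum>i\<in>F. u i) v = (\<Sum>i\<in>F. g p (u i) v)"
      using insert.prems by (intro insert.IH) auto
    moreover have "(\<Sum>i\<in>insert x F. g p (u i) v) = g p (u x) v + (\<Sum>i\<in>F. g p (u i) v)"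
      using insert.hyps by (rule sum.insert)
    ultimately show ?case
      by (simp only:)
  qed
qed (simp add: g_zero assms(2))

lemma g_span_zero:
  assumes "B \<subseteq> T p" "v \<in> T p" "\<And>b. b \<in> B \<Longrightarrow> g p b v = 0" "u \<in> span B"
  shows "g p u v = 0"
proof -
  have "subspace {u \<in> T p. g p u v = 0}"
    using assms(2)
    by (intro subspaceI CollectI) (simp_all add: T_zero T_add T_scale g_zero g_add g_scale)
  then have "span B \<subseteq> {u \<in> T p. g p u v = 0}"
    using assms(1,3) by (intro span_minimal) auto
  then show ?thesis using assms(4) by auto
qed

lemma g_span_orthogonal:
  assumes "B \<subseteq> T p" "C \<subseteq> T p" "\<And>b c. b \<in> B \<Longrightarrow> c \<in> C \<Longrightarrow> g p b c = 0"
    and "u \<in> span B" "w \<in> span C"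
  shows "g p u w = 0"
proof (rule g_span_zero[OF assms(1) _ _ assms(4)])
  show w: "w \<in> T p" using T_span assms(2,5) by blast
  fix b assume b: "b \<in> B"
  have "g p w b = 0"
    using assms(1,3) b subsetD[OF assms(2)] g_sym
    by (intro g_span_zero[OF assms(2) _ _ assms(5)]) (metis subsetD)+
  then show "g p b w = 0" using b assms(1) w g_sym by (metis subsetD)
qed

lemma g_const_span:
  assumes F: "F \<subseteq> smooth_vfields A" and W: "\<And>p. W p \<in> T p"
    and c: "\<And>U p q. U \<in> F \<Longrightarrow> g p (U p) (W p) = g q (U q) (W q)" and U: "U \<in> span F"
  shows "g p (U p) (W p) = g q (U q) (W q)"
proof -
  let ?S = "{U. (\<forall>p. U p \<in> T p) \<and> (\<forall>p q. g p (U p) (W p) = g q (U q) (W q))}"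
  have "subspace ?S"
  proof (intro subspaceI CollectI conjI allI)
    fix x y p q and c :: real
    assume x: "x \<in> ?S"
    then have xT: "\<And>p. x p \<in> T p" and xc: "g p (x p) (W p) = g q (x q) (W q)" by auto
    show "(c *\<^sub>R x) p \<in> T p" using xT by (simp add: scaleR_fun_apply T_scale)
    have "(c *\<^sub>R x) r = c *\<^sub>R x r" for r by (rule scaleR_fun_apply)
    then show "g p ((c *\<^sub>R x) p) (W p) = g q ((c *\<^sub>R x) q) (W q)"
      using xT xc W by (simp only: g_scale)
    assume y: "y \<in> ?S"
    then have yT: "\<And>p. y p \<in> T p" and yc: "g p (y p) (W p) = g q (y q) (W q)" by auto
    show "(x + y) p \<in> T p" using xT yT by (simp add: T_add)
    have "(x + y) r = x r + y r" for r by (rule plus_fun_apply)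
    then show "g p ((x + y) p) (W p) = g q ((x + y) q) (W q)"
      using xT yT xc yc W by (simp only: g_add)
  next
    fix p q
    have "0 r = (0 :: 'a tvec)" for r :: 'a by (rule zero_fun_apply)
    then show "0 p \<in> T p" "g p (0 p) (W p) = g q (0 q) (W q)"
      by (simp_all only: T_zero g_zero W)
  qed
  then have "span F \<subseteq> ?S"
    using F c field_tangent by (intro span_minimal) blast+
  then show ?thesis using U by blast
qed

end


section \<open>Geodesics of a frame with orthogonal brackets\<close>

text \<open>This models the first layer of a Carnot group. The assumption on brackets ranges over real
  linear combinations of the frame, which correspond to left-invariant fields; the inner product
  of two such combinations is constant.\<close>

locale orthogonal_bracket_frame = riemannian A g
  for A :: "('a::topological_space, 'e::euclidean_space) chart set" and g :: "'a metric" +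
  fixes nab :: "'a connection" and X :: "nat \<Rightarrow> 'a vfield" and k :: nat
  assumes atlas: "smooth_atlas A"
    and levi_civita: "levi_civita A g nab"
    and frame: "span (X ` {1..k}) \<subseteq> smooth_vfields A"
    and orthonormal: "orthonormal_frame g X k"
    and bracket_orthogonal: "\<lbrakk>U \<in> span (X ` {1..k}); V \<in> span (X ` {1..k}); W \<in> span (X ` {1..k})\<rbrakk>
      \<Longrightarrow> g p (lie_bracket U V p) (W p) = 0"
begin

abbreviation H where "H \<equiv> span (X ` {1..k})"

lemma horizontal_eq: "horizontal X k p = (\<lambda>U. U p) ` H"
  unfolding horizontal_def using span_eval[of p "X ` {1..k}"] by (simp only: image_image)

lemma H_tangent: "U \<in> H \<Longrightarrow> U p \<in> T p"
  using frame field_tangent by blast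

lemma frame_tangent: "i \<in> {1..k} \<Longrightarrow> X i p \<in> T p"
  by (rule H_tangent) (auto intro: span_base)

lemma horizontal_tangent: "u \<in> horizontal X k p \<Longrightarrow> u \<in> T p"
  by (auto simp: horizontal_eq H_tangent)

lemma nab_tangent: "v \<in> T p \<Longrightarrow> Y \<in> smooth_vfields A \<Longrightarrow> nab p v Y \<in> T p"
  using levi_civita by (simp add: levi_civita_def affine_connection_def)

lemma metric_connection:
  "\<lbrakk>U \<in> smooth_vfields A; Y \<in> smooth_vfields A; Z \<in> smooth_vfields A\<rbrakk> \<Longrightarrow>
    U p (\<lambda>q. g q (Y q) (Z q)) = g p (nab p (U p) Y) (Z p) + g p (Y p) (nab p (U p) Z)"
  using levi_civita by (simp add: levi_civita_def)

lemma torsion_free: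
  "\<lbrakk>U \<in> smooth_vfields A; Y \<in> smooth_vfields A\<rbrakk> \<Longrightarrow>
    nab p (U p) Y - nab p (Y p) U = lie_bracket U Y p"
  using levi_civita by (simp add: levi_civita_def)

lemma g_frame_const:
  assumes "U \<in> H" "W \<in> H"
  shows "g p (U p) (W p) = g q (U q) (W q)"
proof -
  have F: "X ` {1..k} \<subseteq> smooth_vfields A"
    using frame span_superset by blast
  have "g p (U p) (X j p) = g q (U q) (X j q)" if "j \<in> {1..k}" for j p q
    using that orthonormal
    by (intro g_const_span[OF F _ _ assms(1)]) (auto simp: frame_tangent orthonormal_frame_def)
  then have "g p (X j p) (U p) = g q (X j q) (U q)" if "j \<in> {1..k}" for j p q
    using that by (simp add: g_sym[OF frame_tangent H_tangent[OF assms(1)]])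
  then have "g p (W p) (U p) = g q (W q) (U q)"
    by (intro g_const_span[OF F H_tangent[OF assms(1)] _ assms(2)]) auto
  then show ?thesis
    by (simp only: g_sym[OF H_tangent[OF assms(1)] H_tangent[OF assms(2)]])
qed

text \<open>The Koszul formula on \<open>H\<close>, where all its terms vanish: a trilinear form that is
  symmetric in the first two arguments and antisymmetric in the last two is zero.\<close>

lemma nabla_orthogonal:
  assumes "U \<in> H" "V \<in> H" "W \<in> H"
  shows "g p (nab p (U p) V) (W p) = 0"
proof -
  define N where "N U V W = g p (nab p (U p) V) (W p)" for U V W :: "'a vfield"
  have sym: "N U V W = N V U W" if "U \<in> H" "V \<in> H" "W \<in> H" for U V W
  proof -
    have "N U V W - N V U W = g p (lie_bracket U V p) (W p)"
      unfolding N_def using that frame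
      by (subst torsion_free[symmetric]) (auto intro!: g_diff[symmetric] nab_tangent simp: H_tangent)
    then show ?thesis using bracket_orthogonal[OF that] by simp
  qed
  have anti: "N U V W = - N U W V" if "U \<in> H" "V \<in> H" "W \<in> H" for U V W
  proof -
    have "(\<lambda>q. g q (V q) (W q)) = (\<lambda>_. g p (V p) (W p))"
      using g_frame_const that by blast
    then have "U p (\<lambda>q. g q (V q) (W q)) = 0"
      using tangent_vector_const[OF H_tangent[OF that(1)]] by simp
    moreover have "g p (V p) (nab p (U p) W) = N U W V"
      unfolding N_def using that frame by (auto intro!: g_sym simp: nab_tangent H_tangent)
    ultimately show ?thesis
      using metric_connection[of U V W p] that[THEN subsetD[OF frame]] by (simp add: N_def)
  qed
  have "N U V W = - N U V W"
    using assms sym[of U V W] anti[of V U W] sym[of V W U] anti[of W V U] sym[of W U V] anti[of U W V]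
    by simp
  then show ?thesis by (simp add: N_def)
qed

text \<open>Two candidates for the projection differ by a horizontal vector orthogonal to itself.\<close>

lemma orth_proj_unique:
  assumes v: "v \<in> T p"
    and w: "w \<in> horizontal X k p" "\<And>s. s \<in> horizontal X k p \<Longrightarrow> g p (v - w) s = 0"
  shows "orth_proj g p (horizontal X k p) v = w"
  unfolding orth_proj_def
proof (rule the_equality)
  fix w' assume w': "w' \<in> horizontal X k p \<and> (\<forall>s\<in>horizontal X k p. g p (v - w') s = 0)"
  have d: "w - w' \<in> horizontal X k p"
    using w(1) w' unfolding horizontal_def by (blast intro: span_diff)
  have "g p (w - w') (w - w') = g p (v - w') (w - w') - g p (v - w) (w - w')"
    using v w(1) w' d
    by (subst g_diff[symmetric]) (auto simp: horizontal_tangent T_diff)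
  then have "g p (w - w') (w - w') = 0"
    using w(2) w' d by simp
  then show "w' = w"
    using g_pos[of "w - w'" p] horizontal_tangent[OF d] by auto
qed (use w in auto)

lemma orth_proj_eq_0_iff:
  assumes v: "v \<in> T p"
  shows "orth_proj g p (horizontal X k p) v = 0 \<longleftrightarrow> (\<forall>W\<in>H. g p v (W p) = 0)"
proof
  assume *: "\<forall>W\<in>H. g p v (W p) = 0"
  show "orth_proj g p (horizontal X k p) v = 0"
  proof (rule orth_proj_unique[OF v])
    show "0 \<in> horizontal X k p" unfolding horizontal_def by (rule span_zero)
    show "g p (v - 0) s = 0" if "s \<in> horizontal X k p" for s
      unfolding diff_zero using that * by (auto simp: horizontal_eq)
  qed
next
  assume 0: "orth_proj g p (horizontal X k p) v = 0"
  \<comment> \<open>The Fourier expansion in the frame shows that the projection exists.\<close>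
  define w where "w = (\<Sum>i\<in>{1..k}. g p v (X i p) *\<^sub>R X i p)"
  have wh: "w \<in> horizontal X k p"
    unfolding w_def horizontal_def by (intro span_sum span_scale span_base) auto
  have "g p w (X j p) = g p v (X j p)" if j: "j \<in> {1..k}" for j
  proof -
    have "g p w (X j p) = (\<Sum>i\<in>{1..k}. g p v (X i p) * g p (X i p) (X j p))"
      unfolding w_def using j v
      by (subst g_sum) (auto intro!: sum.cong g_scale T_scale frame_tangent)
    also have "\<dots> = (\<Sum>i\<in>{1..k}. if i = j then g p v (X i p) else 0)"
      using j orthonormal by (intro sum.cong) (auto simp: orthonormal_frame_def)
    finally show ?thesis using j by simp
  qed
  then have *: "g p (v - w) (X j p) = 0" if "j \<in> {1..k}" for j
    using that v horizontal_tangent[OF wh] frame_tangent by (simp add: g_diff)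
  have vw: "v - w \<in> T p"
    using v horizontal_tangent[OF wh] by (rule T_diff)
  have **: "g p (v - w) s = 0" if "s \<in> horizontal X k p" for s
  proof (rule g_span_orthogonal)
    show "v - w \<in> span {v - w}" by (rule span_base) simp
    show "s \<in> span ((\<lambda>i. X i p) ` {1..k})" using that by (simp only: horizontal_def)
    show "(\<lambda>i. X i p) ` {1..k} \<subseteq> T p" using frame_tangent by blast
    show "{v - w} \<subseteq> T p" using vw by blast
    show "g p b c = 0" if "b \<in> {v - w}" "c \<in> (\<lambda>i. X i p) ` {1..k}" for b c
      using that * by blast
  qed
  have "w = 0"
    using orth_proj_unique[OF v wh **] 0 by simp
  then show "\<forall>W\<in>H. g p v (W p) = 0"
    using ** by (simp add: horizontal_eq)
qed

text \<open>The velocity is the restriction of \<open>Y\<close>, so the covariant acceleration is \<open>\<nabla>\<^sub>Y Y\<close>.\<close>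

lemma integral_curve_imp_geodesic:
  assumes Y: "Y \<in> H" and c: "integral_curve A Y I \<gamma>"
  shows "nonholonomic_geodesic A g nab X k I \<gamma>"
proof -
  have vel: "velocity A \<gamma> t = Y (\<gamma> t)" if "t \<in> I" for t
    using c that by (simp add: integral_curve_def)
  define Z where "Z t = nab (\<gamma> t) (Y (\<gamma> t)) Y" for t
  have sY: "Y \<in> smooth_vfields A" using Y frame by blast
  have "cov_deriv_along A nab I \<gamma> (velocity A \<gamma>) Z"
    unfolding cov_deriv_along_def
    by (rule exI[of _ 1], rule exI[of _ "\<lambda>_ _. 1"], rule exI[of _ "\<lambda>_. Y"])
      (simp add: Z_def vel sY smooth_on_const)
  moreover have "orth_proj g (\<gamma> t) (horizontal X k (\<gamma> t)) (Z t) = 0" for t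
    using nabla_orthogonal[OF Y Y] sY
    by (subst orth_proj_eq_0_iff) (auto simp: Z_def nab_tangent field_tangent)
  moreover have "velocity A \<gamma> t \<in> horizontal X k (\<gamma> t)" if "t \<in> I" for t
    using Y by (simp add: vel[OF that] horizontal_eq)
  ultimately show ?thesis
    using c unfolding nonholonomic_geodesic_def integral_curve_def by blast
qed

text \<open>The derivative of \<open>g \<gamma>' W\<close> is \<open>g (\<nabla>\<^sub>\<gamma>\<^sub>' \<gamma>') W + g \<gamma>' (\<nabla>\<^sub>\<gamma>\<^sub>' W)\<close>. The first term vanishes by the
  geodesic equation. For the second, the velocity at one fixed parameter is the value of
  some \<open>U \<in> H\<close>, so that \<open>nabla_orthogonal\<close> applies. The product rule along the curve is obtained
  by differentiating term by term an expansion of \<open>\<gamma>'\<close> in ambient fields.\<close>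

lemma geodesic_components_have_zero_derivative:
  assumes geo: "nonholonomic_geodesic A g nab X k I \<gamma>" and W: "W \<in> H" and t: "t \<in> I"
  shows "((\<lambda>s. g (\<gamma> s) (velocity A \<gamma> s) (W (\<gamma> s))) has_real_derivative 0) (at t)"
proof -
  have c: "smooth_curve A I \<gamma>" and hor: "\<And>s. s \<in> I \<Longrightarrow> velocity A \<gamma> s \<in> horizontal X k (\<gamma> s)"
    using geo by (auto simp: nonholonomic_geodesic_def)
  have I: "open I" using c by (simp add: smooth_curve_def)
  have sW: "W \<in> smooth_vfields A" using W frame by blast
  obtain Z where cov: "cov_deriv_along A nab I \<gamma> (velocity A \<gamma>) Z"
    and proj: "\<And>s. s \<in> I \<Longrightarrow> orth_proj g (\<gamma> s) (horizontal X k (\<gamma> s)) (Z s) = 0"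
    using geo unfolding nonholonomic_geodesic_def by blast
  obtain n :: nat and w :: "nat \<Rightarrow> real \<Rightarrow> real" and Y :: "nat \<Rightarrow> 'a vfield" where
    expansion: "\<forall>a<n. smooth_on I (w a) \<and> Y a \<in> smooth_vfields A"
      "\<forall>s\<in>I. velocity A \<gamma> s = (\<Sum>a<n. w a s *\<^sub>R Y a (\<gamma> s)) \<and>
        Z s = (\<Sum>a<n. deriv (w a) s *\<^sub>R Y a (\<gamma> s) +
                      w a s *\<^sub>R nab (\<gamma> s) (velocity A \<gamma> s) (Y a))"
    using cov unfolding cov_deriv_along_def by (elim exE conjE) (rule that)
  have wY: "smooth_on I (w a)" "Y a \<in> smooth_vfields A" if "a < n" for a
    using expansion(1) that by simp_all
  have vel: "velocity A \<gamma> s = (\<Sum>a<n. w a s *\<^sub>R Y a (\<gamma> s))" if "s \<in> I" for s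
    using expansion(2) that by blast
  have Z: "Z s = (\<Sum>a<n. deriv (w a) s *\<^sub>R Y a (\<gamma> s) +
      w a s *\<^sub>R nab (\<gamma> s) (velocity A \<gamma> s) (Y a))" if "s \<in> I" for s
    using expansion(2) that by blast
  obtain U where U: "U \<in> H" "velocity A \<gamma> t = U (\<gamma> t)"
    using hor[OF t] by (auto simp: horizontal_eq)
  have sU: "U \<in> smooth_vfields A" using U frame by blast
  let ?p = "\<gamma> t"
  have tan: "Y a q \<in> T q" "nab ?p (U ?p) (Y a) \<in> T ?p" if "a < n" for a q
    using wY(2)[OF that] field_tangent[OF sU] by (simp_all add: field_tangent nab_tangent)
  have nW: "nab ?p (U ?p) W \<in> T ?p" using sU sW by (simp add: nab_tangent field_tangent)
  define h where "h a = (\<lambda>q. g q (Y a q) (W q))" for a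
  have h: "h a \<in> smooth_functions A" if "a < n" for a
    using metric wY(2)[OF that] sW by (simp add: h_def riemannian_metric_def)
  have dh: "((\<lambda>s. h a (\<gamma> s)) has_real_derivative
      g ?p (nab ?p (U ?p) (Y a)) (W ?p) + g ?p (Y a ?p) (nab ?p (U ?p) W)) (at t)" if "a < n" for a
    using smooth_function_along_curve[OF atlas c h[OF that] t] metric_connection[of U "Y a" W ?p]
      U(2) sU sW wY(2)[OF that] by (simp add: h_def)
  have dw: "(w a has_real_derivative deriv (w a) t) (at t)" if "a < n" for a
  proof -
    have "w a differentiable (at t)"
      using wY(1)[OF that] t by (rule smooth_on_imp_differentiable)
    then show ?thesis
      using DERIV_deriv_iff_real_differentiable by blast
  qed
  have ZT: "Z t \<in> T ?p"
    unfolding Z[OF t] U(2) using tan by (intro T_sum T_add T_scale) auto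
  have gZ: "g ?p (Z t) (W ?p) =
      (\<Sum>a<n. deriv (w a) t * h a ?p + w a t * g ?p (nab ?p (U ?p) (Y a)) (W ?p))"
    unfolding Z[OF t] U(2) h_def using tan W
    by (subst g_sum) (auto simp: g_add g_scale H_tangent T_add T_scale intro!: sum.cong)
  have U_sum: "U ?p = (\<Sum>a<n. w a t *\<^sub>R Y a ?p)"
    by (rule trans[OF U(2)[symmetric] vel[OF t]])
  have "g ?p (\<Sum>a<n. w a t *\<^sub>R Y a ?p) (nab ?p (U ?p) W) =
      (\<Sum>a<n. w a t * g ?p (Y a ?p) (nab ?p (U ?p) W))"
    using tan nW by (subst g_sum) (auto simp: g_scale T_scale intro!: sum.cong)
  then have gU: "g ?p (U ?p) (nab ?p (U ?p) W) = (\<Sum>a<n. w a t * g ?p (Y a ?p) (nab ?p (U ?p) W))"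
    by (simp only: U_sum[symmetric])
  have "((\<lambda>s. \<Sum>a<n. w a s * h a (\<gamma> s)) has_real_derivative
      (\<Sum>a<n. deriv (w a) t * h a ?p +
        (g ?p (nab ?p (U ?p) (Y a)) (W ?p) + g ?p (Y a ?p) (nab ?p (U ?p) W)) * w a t)) (at t)"
    by (intro DERIV_sum DERIV_mult) (auto intro: dw dh)
  moreover have "(\<Sum>a<n. deriv (w a) t * h a ?p +
        (g ?p (nab ?p (U ?p) (Y a)) (W ?p) + g ?p (Y a ?p) (nab ?p (U ?p) W)) * w a t) =
      g ?p (Z t) (W ?p) + g ?p (U ?p) (nab ?p (U ?p) W)"
    unfolding gZ gU sum.distrib[symmetric] by (intro sum.cong) (auto simp: algebra_simps)
  moreover have "g ?p (Z t) (W ?p) = 0"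
    using proj[OF t] orth_proj_eq_0_iff[OF ZT] W by blast
  moreover have "g ?p (U ?p) (nab ?p (U ?p) W) = 0"
    using nabla_orthogonal[OF U(1) W U(1)] nW H_tangent[OF U(1)] g_sym by metis
  ultimately have "((\<lambda>s. \<Sum>a<n. w a s * h a (\<gamma> s)) has_real_derivative 0) (at t)"
    by simp
  moreover have "(\<Sum>a<n. w a s * h a (\<gamma> s)) = g (\<gamma> s) (velocity A \<gamma> s) (W (\<gamma> s))" if "s \<in> I" for s
    unfolding vel[OF that] h_def using tan W
    by (subst g_sum) (auto simp: g_scale H_tangent T_scale intro!: sum.cong)
  ultimately show ?thesis
    by (rule has_field_derivative_transform_within_open[OF _ I t])
qed

text \<open>Take the field of \<open>H\<close> that gives the velocity at one parameter. Its inner products with fields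
  of \<open>H\<close> are constant on the whole space, those of the velocity are constant along the curve, and
  both agree at that parameter.\<close>

lemma geodesic_imp_integral_curve:
  assumes geo: "nonholonomic_geodesic A g nab X k I \<gamma>"
  shows "\<exists>Y\<in>H. integral_curve A Y I \<gamma>"
proof (cases "I = {}")
  case True
  then show ?thesis
    using geo span_zero[of "X ` {1..k}"]
    by (auto simp: nonholonomic_geodesic_def integral_curve_def)
next
  case False
  then obtain t0 where t0: "t0 \<in> I" by blast
  have c: "smooth_curve A I \<gamma>" and hor: "\<And>s. s \<in> I \<Longrightarrow> velocity A \<gamma> s \<in> horizontal X k (\<gamma> s)"
    using geo by (auto simp: nonholonomic_geodesic_def)
  obtain Y where Y: "Y \<in> H" "velocity A \<gamma> t0 = Y (\<gamma> t0)"
    using hor[OF t0] by (auto simp: horizontal_eq)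
  have "velocity A \<gamma> t = Y (\<gamma> t)" if t: "t \<in> I" for t
  proof -
    obtain U where U: "U \<in> H" "velocity A \<gamma> t = U (\<gamma> t)"
      using hor[OF t] by (auto simp: horizontal_eq)
    \<comment> \<open>The difference of the two fields is itself an admissible test field.\<close>
    define D where "D = U - Y"
    have D: "D \<in> H" unfolding D_def using U Y by (blast intro: span_diff)
    have "convex I" using c by (simp add: smooth_curve_def is_interval_convex)
    then have "\<exists>K. \<forall>s\<in>I. g (\<gamma> s) (velocity A \<gamma> s) (D (\<gamma> s)) = K"
      by (intro has_field_derivative_zero_constant)
        (auto intro: has_field_derivative_at_within geodesic_components_have_zero_derivative[OF geo D])
    then have "g (\<gamma> t) (U (\<gamma> t)) (D (\<gamma> t)) = g (\<gamma> t0) (Y (\<gamma> t0)) (D (\<gamma> t0))"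
      using t t0 U(2) Y(2) by metis
    also have "\<dots> = g (\<gamma> t) (Y (\<gamma> t)) (D (\<gamma> t))"
      using Y(1) D by (rule g_frame_const)
    finally have "g (\<gamma> t) (U (\<gamma> t)) (D (\<gamma> t)) = g (\<gamma> t) (Y (\<gamma> t)) (D (\<gamma> t))" .
    moreover have "D (\<gamma> t) = U (\<gamma> t) - Y (\<gamma> t)"
      unfolding D_def by simp
    ultimately have "g (\<gamma> t) (D (\<gamma> t)) (D (\<gamma> t)) = 0"
      using g_diff[OF H_tangent[OF U(1)] H_tangent[OF Y(1)] H_tangent[OF D], of "\<gamma> t"] by simp
    then have "D (\<gamma> t) = 0"
      using g_pos[OF H_tangent[OF D, of "\<gamma> t"]] by force
    then show ?thesis by (simp add: U(2) D_def)
  qed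
  then show ?thesis
    using Y(1) c by (auto simp: integral_curve_def)
qed

theorem nonholonomic_geodesic_iff:
  "nonholonomic_geodesic A g nab X k I \<gamma> \<longleftrightarrow> (\<exists>Y\<in>H. integral_curve A Y I \<gamma>)"
  using geodesic_imp_integral_curve integral_curve_imp_geodesic by blast

end


section \<open>The first layer of a Carnot group\<close>

lemma adapted_basis_first_layer:
  assumes "carnot_group G A V l" "adapted_basis G A V l X m k"
  shows "V 1 = span (X ` {1..k})" "k \<le> m"
proof -
  obtain d where d: "mono d" "d 0 = (0::nat)" "d 1 = k" "d l = m"
    "\<forall>i\<in>{1..l}. V i = span (X ` {d (i - 1)<..d i})"
    using assms(2) by (auto simp: adapted_basis_def)
  have l: "1 \<le> l" using assms(1) by (simp add: carnot_group_def stratification_def)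
  show "k \<le> m" using monoD[OF d(1) l] d by simp
  have "{d (1 - 1)<..d 1} = {1..k}" using d by auto
  then show "V 1 = span (X ` {1..k})" using d(5) l by auto
qed

text \<open>Brackets of the first layer lie in the second layer, whose basis fields are numbered after
  \<open>k\<close>. With a single layer the brackets vanish.\<close>

lemma first_layer_bracket:
  assumes C: "carnot_group G A V l" and B: "adapted_basis G A V l X m k"
    and UW: "U \<in> V 1" "W \<in> V 1"
  shows "lie_bracket U W \<in> span (X ` {k<..m})"
proof -
  obtain d where d: "mono d" "d 1 = k" "d l = m"
    "\<forall>i\<in>{1..l}. V i = span (X ` {d (i - 1)<..d i})"
    using B by (auto simp: adapted_basis_def)
  have st: "1 \<le> l" "\<forall>i. 1 \<le> i \<and> i < l \<longrightarrow> bracket_space (V 1) (V i) = V (Suc i)"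
    "bracket_space (V 1) (V l) = {0}"
    using C by (auto simp: carnot_group_def stratification_def)
  have br: "lie_bracket U W \<in> bracket_space (V 1) (V 1)"
    using UW unfolding bracket_space_def by (blast intro: span_base)
  show ?thesis
  proof (cases "l = 1")
    case True
    then show ?thesis using br st(3) by (simp add: span_zero)
  next
    case False
    then have l: "1 < l" using st(1) by simp
    then have "bracket_space (V 1) (V 1) = V (Suc 1)" using st(2) by blast
    moreover have "V (Suc 1) = span (X ` {d (Suc 1 - 1)<..d (Suc 1)})"
      using d(4) l by (simp add: Suc_leI)
    moreover have "d (Suc 1) \<le> m" using monoD[OF d(1), of "Suc 1" l] l d(3) by simp
    ultimately show ?thesis
      using br d(2) span_mono[of "X ` {k<..d (Suc 1)}" "X ` {k<..m}"] by fastforce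
  qed
qed

lemma carnot_orthogonal_bracket_frame:
  fixes G :: "'a::{t2_space, second_countable_topology} monoid"
    and A :: "('a, 'e::euclidean_space) chart set"
  assumes C: "carnot_group G A V l" and B: "adapted_basis G A V l X m k"
    and M: "left_inv_metric G A g" and O: "orthonormal_frame g X m"
    and L: "levi_civita A g nab"
  shows "orthogonal_bracket_frame A g nab X k"
proof -
  note V1 = adapted_basis_first_layer[OF C B]
  have metric: "riemannian_metric A g" using M by (simp add: left_inv_metric_def)
  have XS: "span (X ` {1..m}) \<subseteq> smooth_vfields A"
    using B by (auto simp: adapted_basis_def left_inv_vfields_def)
  interpret riemannian A g by standard (rule metric)
  have base: "X i p \<in> T p" if "i \<in> {1..m}" for i p
    using XS that by (auto intro!: field_tangent span_base)
  have sub1: "span (X ` {1..k}) \<subseteq> span (X ` {1..m})"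
    using V1(2) by (intro span_mono image_mono) auto
  have orth: "g p (Z p) (W p) = 0" if "Z \<in> span (X ` {k<..m})" "W \<in> span (X ` {1..k})" for p Z W
  proof (rule g_span_orthogonal)
    show "Z p \<in> span ((\<lambda>U. U p) ` X ` {k<..m})" "W p \<in> span ((\<lambda>U. U p) ` X ` {1..k})"
      using that by (auto simp: span_eval)
    show "(\<lambda>U. U p) ` X ` {k<..m} \<subseteq> T p" "(\<lambda>U. U p) ` X ` {1..k} \<subseteq> T p"
      using V1(2) by (auto intro!: base)
    fix b c assume "b \<in> (\<lambda>U. U p) ` X ` {k<..m}" "c \<in> (\<lambda>U. U p) ` X ` {1..k}"
    then show "g p b c = 0"
      using O V1(2) by (auto simp: orthonormal_frame_def)
  qed
  show ?thesis
  proof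
    show "smooth_atlas A" using C by (simp add: carnot_group_def lie_group_def)
    show "orthonormal_frame g X k"
      using O V1(2) by (auto simp: orthonormal_frame_def)
    show "g p (lie_bracket U V' p) (W p) = 0"
      if "U \<in> span (X ` {1..k})" "V' \<in> span (X ` {1..k})" "W \<in> span (X ` {1..k})" for U V' W p
      using orth[OF first_layer_bracket[OF C B] that(3)] that V1 by simp
  qed (use L XS sub1 in auto)
qed

text \<open>The value at the identity of such a field is also the value of a field of the first layer, and
  left translation carries this equality to every point.\<close>

lemma left_inv_horizontal_vfields_eq:
  fixes G :: "'a::{t2_space, second_countable_topology} monoid"
  assumes C: "carnot_group G A V l" and B: "adapted_basis G A V l X m k"
  shows "left_inv_horizontal_vfields G A X k = span (X ` {1..k})"
proof
  have grp: "group G" "carrier G = UNIV"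
    using C by (auto simp: carnot_group_def lie_group_def)
  have hor: "horizontal X k p = (\<lambda>U. U p) ` span (X ` {1..k})" for p
    unfolding horizontal_def using span_eval[of p "X ` {1..k}"] by (simp only: image_image)
  have "V 1 \<subseteq> left_inv_vfields G A"
    using C by (simp add: carnot_group_def stratification_def)
  then have sub: "span (X ` {1..k}) \<subseteq> left_inv_vfields G A"
    using adapted_basis_first_layer(1)[OF C B] by simp
  then show "span (X ` {1..k}) \<subseteq> left_inv_horizontal_vfields G A X k"
    by (auto simp: left_inv_horizontal_vfields_def hor)
  show "left_inv_horizontal_vfields G A X k \<subseteq> span (X ` {1..k})"
  proof
    fix Y assume Y: "Y \<in> left_inv_horizontal_vfields G A X k"
    then obtain U where U: "U \<in> span (X ` {1..k})" "Y \<one>\<^bsub>G\<^esub> = U \<one>\<^bsub>G\<^esub>"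
      by (auto simp: left_inv_horizontal_vfields_def hor)
    have "Y p = U p" for p
    proof -
      have "Y (p \<otimes>\<^bsub>G\<^esub> \<one>\<^bsub>G\<^esub>) = U (p \<otimes>\<^bsub>G\<^esub> \<one>\<^bsub>G\<^esub>)"
        using Y U sub unfolding left_inv_horizontal_vfields_def left_inv_vfields_def
        by (auto simp: subset_iff)
      then show ?thesis using monoid.r_one[OF group.is_monoid[OF grp(1)], of p] grp(2) by simp
    qed
    then show "Y \<in> span (X ` {1..k})" using U(1) by (metis ext)
  qed
qed


section \<open>Equality of the two notions of convexity\<close>

theorem proposition4p3:
  fixes G :: "'a::{t2_space, second_countable_topology} monoid"
    and A :: "('a, 'e::euclidean_space) chart set"
    and V :: "nat \<Rightarrow> 'a vfield set" and X :: "nat \<Rightarrow> 'a vfield"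
    and l m k :: nat
    and g :: "'a metric" and nab :: "'a connection"
    and \<Omega> :: "'a set" and f :: "'a \<Rightarrow> real"
  assumes "carnot_group G A V l"
    and "adapted_basis G A V l X m k"
    and "left_inv_metric G A g" and "orthonormal_frame g X m"
    and "levi_civita A g nab"
  shows "n_convex_fun A g nab X k \<Omega> f \<longleftrightarrow> h_convex_fun G A X k \<Omega> f"
proof -
  interpret orthogonal_bracket_frame A g nab X k
    using assms by (rule carnot_orthogonal_bracket_frame)
  have curves: "nonholonomic_geodesic A g nab X k I \<gamma> \<longleftrightarrow>
      (\<exists>Y\<in>left_inv_horizontal_vfields G A X k. integral_curve A Y I \<gamma>)" for I \<gamma>
    by (simp only: nonholonomic_geodesic_iff left_inv_horizontal_vfields_eq[OF assms(1,2)])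
  have "n_convex_set A g nab X k \<Omega> \<longleftrightarrow> h_convex_set G A X k \<Omega>"
    unfolding n_convex_set_def h_convex_set_def curves by fast
  moreover have "(\<forall>I \<gamma>. nonholonomic_geodesic A g nab X k I \<gamma> \<longrightarrow> P I \<gamma>) \<longleftrightarrow>
      (\<forall>Y\<in>left_inv_horizontal_vfields G A X k. \<forall>I \<gamma>. integral_curve A Y I \<gamma> \<longrightarrow> P I \<gamma>)" for P
    unfolding curves by fast
  ultimately show ?thesis
    by (simp only: n_convex_fun_def h_convex_fun_def)
qed

end
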